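(* Let $\delta\in(0,1)$ and let $\alpha\in(0,1)$ be an irrational number of Diophantine class $\nu=1$. Let $f\colon S^1\to S^1$ be a Denjoy map that is semi-conjugate to the rotation $R_\alpha$, with gaps $J_n$, $n\in\mathbb{Z}$, whose lengths $|J_n|=\ell_n$ form a Denjoy sequence of class $\delta$, and let $\Omega_f=S^1\setminus\bigcup_{n\in\mathbb{Z}}J_n$ be its minimal set. Suppose that for every $\varepsilon>0$ there exist a subsequence $(n_s)_{s\ge1}$ of the positive integers and a constant $C<\infty$ such that, for all $s$, $$\sum_{|k|>n_s}|J_k|\leq C\,n_s^{1-\frac{1}{\delta+\varepsilon}} .$$ Then $\dim_H(\Omega_f)=\delta$.
   Context: $S^1$ is the circle of total length $1$ with the arc-length metric, and $R_\alpha(t)=t+\alpha \pmod 1$. $\|x\|$ is the distance from $x$ to the nearest integer. A subsequence of the positive integers means a strictly increasing sequence. Denjoy sequence of class $\delta\in(0,1)$: a sequence $(\ell_n)_{n\in\mathbb{Z}}$ of non-negative numbers (such that the logarithms below make sense) with $$\sum_{n\in\mathbb{Z}}\ell_n=1\qquad\text{and}\qquad \liminf_{n\to\pm\infty}\frac{\ln|\ell_n-\ell_{n+1}|}{\ln \ell_n}=1+\delta .$$ Denjoy map: given an irrational $\alpha\in(0,1)$ and a Denjoy sequence $(\ell_n)_{n\in\mathbb{Z}}$ of class $\delta$, start with the circle of length $1$ and the rotation $R_\alpha$, and blow up every point $n\alpha$ ($n\in\mathbb{Z}$) of the orbit of $0$ to an open arc $J_n$ of length $|J_n|=\ell_n$,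 rescaling the rest so that the total length remains $1$. Thus the arcs $J_n$ are pairwise disjoint and are placed on $S^1$ in the same cyclic order as the points $n\alpha$. The Denjoy map $f\colon S^1\to S^1$ is an orientation preserving diffeomorphism, of class $C^{1+\delta}$, mapping each $J_n$ diffeomorphically onto $J_{n+1}$ with derivative $1$ at the endpoints. It is semi-conjugate to $R_\alpha$, i.e. $h\circ f=R_\alpha\circ h$, by the continuous monotone surjection $h\colon S^1\to S^1$ that collapses the closure of each $J_n$ to the point $n\alpha$ and is injective elsewhere. The set $\Omega_f=S^1\setminus\bigcup_{n\in\mathbb{Z}}J_n$ is the unique minimal set of $f$. Diophantine class: an irrational $\alpha\in(0,1)$ is of Diophantine class $\nu\in[1,+\infty]$ if the inequality $\|q\alpha\|<q^{-\mu}$ has infinitely many positive integer solutions $q$ for every $\mu<\nu$ and only finitely many for every $\mu>\nu$. Hausdorff measure and dimension: $H_\beta(Y)=\lim_{r\to0}\inf\{\sum_{k=1}^\infty(\operatorname{diam}U_k)^\beta : \operatorname{diam}U_k<r \text{ for all } k,\ Y\subset\bigcup_{k=1}^\infty U_k\}$ and $\dim_H(Y)=\inf\{\beta\ge0 : H_\beta(Y)=0\}$. *)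

theory Defs
  imports "HOL-Analysis.Analysis"
begin

section \<open>The circle of length 1\<close>

abbreviation dist_int :: "real \<Rightarrow> real" where
  "dist_int x \<equiv> infdist x \<int>"

lemma dist_int_attained: obtains m where "m \<in> \<int>" "dist_int x = \<bar>x - m\<bar>"
proof -
  have "(\<int> :: real set) \<noteq> {}"
    using Ints_0 by blast
  from infdist_attains_inf[OF closed_Ints this, of x] that show thesis
    by (auto simp: dist_real_def)
qed

lemma dist_int_le: "m \<in> \<int> \<Longrightarrow> dist_int x \<le> \<bar>x - m\<bar>"
  using infdist_le[of m \<int> x] by (simp add: dist_real_def)

lemma dist_int_eq_0_iff: "dist_int x = 0 \<longleftrightarrow> x \<in> \<int>"
proof -
  have "(\<int> :: real set) \<noteq> {}"
    using Ints_0 by blast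
  from in_closed_iff_infdist_zero[OF closed_Ints this, of x] show ?thesis
    by simp
qed

lemma dist_int_add_le: "dist_int (x + y) \<le> dist_int x + dist_int y"
proof -
  obtain m k where "m \<in> \<int>" "dist_int x = \<bar>x - m\<bar>" "k \<in> \<int>" "dist_int y = \<bar>y - k\<bar>"
    using dist_int_attained[of x] dist_int_attained[of y] by metis
  then show ?thesis
    using dist_int_le[of "m + k" "x + y"] by simp
qed

lemma dist_int_minus_le: "dist_int (- x) \<le> dist_int x"
proof -
  obtain m where "m \<in> \<int>" "dist_int x = \<bar>x - m\<bar>"
    by (rule dist_int_attained)
  then show ?thesis
    using dist_int_le[of "- m" "- x"] by simp
qed

lemma dist_int_minus_commute: "dist_int (x - y) = dist_int (y - x)"
  using dist_int_minus_le[of "x - y"] dist_int_minus_le[of "y - x"] by simp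

lemma dist_int_add_Ints: "k \<in> \<int> \<Longrightarrow> dist_int (x + k) = dist_int x"
  using dist_int_add_le[of x k] dist_int_add_le[of "x + k" "- k"]
    dist_int_eq_0_iff[of k] dist_int_eq_0_iff[of "- k"] by simp

quotient_type circle = real / "\<lambda>x y :: real. x - y \<in> \<int>"
  morphisms rep_circle to_circle
proof (rule equivpI)
  show "reflp (\<lambda>x y :: real. x - y \<in> \<int>)"
    by (simp add: reflp_def)
  show "symp (\<lambda>x y :: real. x - y \<in> \<int>)"
    using Ints_minus[of "x - y" for x y :: real] by (auto intro!: sympI)
  show "transp (\<lambda>x y :: real. x - y \<in> \<int>)"
    using Ints_add[of "x - y" "y - z" for x y z :: real] by (auto intro!: transpI)
qed

instantiation circle :: metric_space
begin

lift_definition dist_circle :: "circle \<Rightarrow> circle \<Rightarrow> real" is "\<lambda>x y. dist_int (x - y)"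
proof -
  fix x x' y y' :: real
  assume "x - x' \<in> \<int>" "y - y' \<in> \<int>"
  then have "(x - x') - (y - y') \<in> \<int>"
    by (rule Ints_diff)
  from dist_int_add_Ints[OF this, of "x' - y'"]
  show "dist_int (x - y) = dist_int (x' - y')"
    by (simp add: algebra_simps)
qed

definition uniformity_circle :: "(circle \<times> circle) filter" where
  "uniformity_circle = (INF e\<in>{0<..}. principal {(x, y). dist x y < e})"

definition open_circle :: "circle set \<Rightarrow> bool" where
  "open_circle U \<longleftrightarrow> (\<forall>x\<in>U. \<forall>\<^sub>F (x', y) in uniformity. x' = x \<longrightarrow> y \<in> U)"

instance
proof
  fix x y z :: circle
  show "dist x y = 0 \<longleftrightarrow> x = y"
    by transfer (rule dist_int_eq_0_iff)
  show "dist x y \<le> dist x z + dist y z"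
  proof transfer
    fix x y z :: real
    show "dist_int (x - y) \<le> dist_int (x - z) + dist_int (y - z)"
      using dist_int_add_le[of "x - z" "z - y"] dist_int_minus_commute[of z y] by simp
  qed
qed (rule uniformity_circle_def open_circle_def)+

end

lift_definition rotation :: "real \<Rightarrow> circle \<Rightarrow> circle" is "\<lambda>a t. t + a"
  by simp

definition open_arc :: "real \<Rightarrow> circle set \<Rightarrow> bool" where
  "open_arc L A \<longleftrightarrow> 0 < L \<and> L < 1 \<and> (\<exists>a. A = to_circle ` {a<..<a + L})"

section \<open>Maps of the circle\<close>

definition circle_lift :: "(circle \<Rightarrow> circle) \<Rightarrow> (real \<Rightarrow> real) \<Rightarrow> bool" where
  "circle_lift f F \<longleftrightarrow> continuous_on UNIV F \<and> (\<forall>x. f (to_circle x) = to_circle (F x))"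

text \<open>Continuous and monotone in the sense of the cyclic order, of degree one.  For a homeomorphism
  this says that it preserves the orientation.\<close>

definition monotone_circle_map :: "(circle \<Rightarrow> circle) \<Rightarrow> bool" where
  "monotone_circle_map f \<longleftrightarrow>
     (\<exists>F. circle_lift f F \<and> mono F \<and> (\<forall>x. F (x + 1) = F x + 1))"

definition has_circle_derivative :: "(circle \<Rightarrow> circle) \<Rightarrow> real \<Rightarrow> circle \<Rightarrow> bool" where
  "has_circle_derivative f D t \<longleftrightarrow>
     (\<exists>F x. circle_lift f F \<and> t = to_circle x \<and> (F has_real_derivative D) (at x))"

text \<open>The class \<open>C\<^bsup>1+d\<^esup>\<close>: the derivative is Hoelder continuous with exponent \<open>d\<close>.\<close>

definition circle_C1_Hoelder :: "real \<Rightarrow> (circle \<Rightarrow> circle) \<Rightarrow> bool" where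
  "circle_C1_Hoelder d f \<longleftrightarrow>
     (\<exists>F F'. circle_lift f F \<and> (\<forall>x. (F has_real_derivative F' x) (at x)) \<and>
        (\<exists>C. \<forall>x y. \<bar>F' x - F' y\<bar> \<le> C * \<bar>x - y\<bar> powr d))"

definition orientation_preserving_diffeo :: "real \<Rightarrow> (circle \<Rightarrow> circle) \<Rightarrow> bool" where
  "orientation_preserving_diffeo d f \<longleftrightarrow>
     bij f \<and> circle_C1_Hoelder d f \<and> circle_C1_Hoelder d (inv f) \<and> monotone_circle_map f"

section \<open>Denjoy maps\<close>

text \<open>The finiteness clause and \<open>l n > 0\<close> express that the logarithms make sense (for large
  \<open>\<bar>n\<bar>\<close>, which is all that matters for the lower limit); \<open>ln (l n) \<noteq> 0\<close> is then automatic, as all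
  \<open>l n\<close> are positive with sum 1.  The lower limit is the joint one, for \<open>\<bar>n\<bar> \<rightarrow> \<infinity>\<close>.\<close>

definition Denjoy_sequence :: "real \<Rightarrow> (int \<Rightarrow> real) \<Rightarrow> bool" where
  "Denjoy_sequence d l \<longleftrightarrow>
     (\<forall>n. l n > 0) \<and> finite {n. l n = l (n + 1)} \<and> (l has_sum 1) UNIV \<and>
     Liminf (sup at_bot at_top) (\<lambda>n. ereal (ln \<bar>l n - l (n + 1)\<bar> / ln (l n))) = ereal (1 + d)"

text \<open>\<open>f\<close> is a Denjoy map over the rotation by \<open>\<alpha>\<close> with gaps \<open>J n\<close> of length \<open>l n\<close>.  That the gaps
  lie in the same cyclic order as the points \<open>n\<alpha>\<close> is contained in the monotonicity of \<open>h\<close>.\<close>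

definition Denjoy_map ::
  "real \<Rightarrow> real \<Rightarrow> (int \<Rightarrow> real) \<Rightarrow> (int \<Rightarrow> circle set) \<Rightarrow> (circle \<Rightarrow> circle) \<Rightarrow> bool" where
  "Denjoy_map d \<alpha> l J f \<longleftrightarrow>
     Denjoy_sequence d l \<and>
     (\<forall>n. open_arc (l n) (J n)) \<and> disjoint_family J \<and>
     orientation_preserving_diffeo d f \<and>
     (\<forall>n. f ` J n = J (n + 1) \<and> (\<forall>t\<in>frontier (J n). has_circle_derivative f 1 t)) \<and>
     (\<exists>h. monotone_circle_map h \<and> surj h \<and> h \<circ> f = rotation \<alpha> \<circ> h \<and>
        (\<forall>n. h ` closure (J n) = {to_circle (of_int n * \<alpha>)}) \<and>
        inj_on h (UNIV - (\<Union>n. closure (J n))))"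

definition minimal_set :: "(int \<Rightarrow> circle set) \<Rightarrow> circle set" where
  "minimal_set J = UNIV - (\<Union>n. J n)"

section \<open>Diophantine class\<close>

definition Diophantine_class :: "real \<Rightarrow> ereal \<Rightarrow> bool" where
  "Diophantine_class \<alpha> \<nu> \<longleftrightarrow>
     \<alpha> \<in> {0<..<1} \<and> \<alpha> \<notin> \<rat> \<and> 1 \<le> \<nu> \<and>
     (\<forall>\<mu>. ereal \<mu> < \<nu> \<longrightarrow> infinite {q::nat. q > 0 \<and> dist_int (real q * \<alpha>) < real q powr (- \<mu>)}) \<and>
     (\<forall>\<mu>. ereal \<mu> > \<nu> \<longrightarrow> finite {q::nat. q > 0 \<and> dist_int (real q * \<alpha>) < real q powr (- \<mu>)})"

section \<open>Hausdorff measure and dimension\<close>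

text \<open>\<open>(diam U)\<^sup>\<beta>\<close> with the conventions \<open>(diam U)\<^sup>0 = 1\<close> for nonempty \<open>U\<close>, whereas \<open>0 powr 0 = 0\<close>,
  and \<open>(diam {})\<^sup>\<beta> = 0\<close>.\<close>

definition diam_powr :: "real \<Rightarrow> 'a::metric_space set \<Rightarrow> ennreal" where
  "diam_powr \<beta> U =
     (if U = {} then 0 else if \<beta> = 0 then 1 else ennreal (diameter U powr \<beta>))"

text \<open>\<open>diameter\<close> is meaningful for bounded sets only.\<close>

definition Hausdorff_premeasure :: "real \<Rightarrow> real \<Rightarrow> 'a::metric_space set \<Rightarrow> ennreal" where
  "Hausdorff_premeasure \<beta> r Y =
     Inf {\<Sum>k. diam_powr \<beta> (U k) | U :: nat \<Rightarrow> 'a set.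
            (\<forall>k. bounded (U k) \<and> diameter (U k) < r) \<and> Y \<subseteq> (\<Union>k. U k)}"

definition Hausdorff_measure :: "real \<Rightarrow> 'a::metric_space set \<Rightarrow> ennreal" where
  "Hausdorff_measure \<beta> Y = Lim (at_right 0) (\<lambda>r. Hausdorff_premeasure \<beta> r Y)"

definition Hausdorff_dim :: "'a::metric_space set \<Rightarrow> ereal" where
  "Hausdorff_dim Y = Inf {ereal \<beta> | \<beta>. \<beta> \<ge> 0 \<and> Hausdorff_measure \<beta> Y = 0}"

lemma Hausdorff_premeasure_antimono:
  assumes "r \<le> r'"
  shows "Hausdorff_premeasure \<beta> r' Y \<le> Hausdorff_premeasure \<beta> r Y"
  unfolding Hausdorff_premeasure_def using assms
  by (intro Inf_superset_mono) (blast intro: less_le_trans)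

lemma Hausdorff_premeasure_tendsto:
  "((\<lambda>r. Hausdorff_premeasure \<beta> r Y) \<longlongrightarrow> (SUP r\<in>{0<..}. Hausdorff_premeasure \<beta> r Y)) (at_right 0)"
proof (rule order_tendstoI)
  fix a assume "a < (SUP r\<in>{0<..}. Hausdorff_premeasure \<beta> r Y)"
  then obtain r where r: "r > 0" "a < Hausdorff_premeasure \<beta> r Y"
    by (auto simp: less_SUP_iff)
  then have "a < Hausdorff_premeasure \<beta> s Y" if "s < r" for s
    using Hausdorff_premeasure_antimono[of s r \<beta> Y] that by (simp add: less_le_trans)
  then show "\<forall>\<^sub>F r in at_right 0. a < Hausdorff_premeasure \<beta> r Y"
    using r(1) unfolding eventually_at_right_field by blast
next
  fix a assume "(SUP r\<in>{0<..}. Hausdorff_premeasure \<beta> r Y) < a"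
  then have "Hausdorff_premeasure \<beta> s Y < a" if "s > 0" for s
    using that by (metis SUP_lessD greaterThan_iff)
  then show "\<forall>\<^sub>F r in at_right 0. Hausdorff_premeasure \<beta> r Y < a"
    by (simp add: eventually_at_filter)
qed

lemma Hausdorff_measure_eq_SUP:
  "Hausdorff_measure \<beta> Y = (SUP r\<in>{0<..}. Hausdorff_premeasure \<beta> r Y)"
  unfolding Hausdorff_measure_def
  by (rule tendsto_Lim[OF _ Hausdorff_premeasure_tendsto]) simp

end

theory Submission
  imports Defs
begin

text \<open>
  The upper bound \<open>\<delta>\<close> for the dimension comes from the obvious covers.  Removing the gaps \<open>J k\<close> with
  \<open>\<bar>k\<bar> \<le> N\<close> leaves \<open>2 N + 1\<close> arcs that cover the minimal set (\<open>circle_gaps_cover\<close>), and their total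
  length is the tail \<open>\<Sum>\<bar>k\<bar>>N. l k\<close>.  Where the tail is \<open>O(N powr (1 - 1 / \<sigma>))\<close>, the sum of the \<open>\<beta>\<close>-th powers of
  the lengths is \<open>O(N powr (1 - \<beta> / \<sigma>))\<close> (\<open>powr_le_const_plus_linear\<close>).  Along the given subsequence this
  tends to 0 if \<open>\<sigma> = \<delta> + \<epsilon> < \<beta>\<close> (\<open>Denjoy_map_Hausdorff_measure_eq_0\<close>).

  The lower bound rests on the fact that the semi-conjugacy \<open>h\<close> to the rotation is Hoelder continuous
  with every exponent \<open>p < \<delta>\<close> (\<open>lift_Hoelder\<close>); as \<open>h\<close> maps the minimal set onto the circle up to
  countably many points, the mass distribution principle (\<open>Hausdorff_measure_pos\<close>) then shows that
  \<open>H\<^sub>\<beta>\<close> is positive for \<open>\<beta> \<le> p\<close>.  The Hoelder bound combines two estimates.  The Diophantine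
  condition lets the forward orbit of the rotation meet each interval of length \<open>t\<close> at a time
  \<open>n = O(t powr (- \<mu>))\<close>, for any \<open>\<mu> > 1\<close> (\<open>rotation_orbit_hits_interval\<close>).  The class of the Denjoy
  sequence forces \<open>l n \<ge> const * n powr (- (1 / \<gamma>))\<close> for any \<open>\<gamma> < \<delta>\<close>
  (\<open>Denjoy_sequence_lower_bound\<close>): the increments \<open>l n powr (1 + \<gamma>)\<close> are too small for a faster decay.
  So an arc on which \<open>h\<close> gains height \<open>t\<close> contains a gap of length at least
  \<open>const * t powr (\<mu> / \<gamma>)\<close>; that single gap already makes the arc long enough.
\<close>

section \<open>Points and arcs of the circle\<close>

lemma to_circle_eq_iff: "to_circle x = to_circle y \<longleftrightarrow> x - y \<in> \<int>"
  by (rule circle.abs_eq_iff)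

lemma to_circle_add_int [simp]: "to_circle (x + of_int m) = to_circle x"
  by (simp add: to_circle_eq_iff)

lemma to_circle_cases:
  obtains x where "c \<le> x" "x < c + 1" "u = to_circle x"
proof -
  have "\<exists>y. u = to_circle y"
    by (rule circle.abs_induct) blast
  then obtain y where y: "u = to_circle y" ..
  show thesis
  proof (rule that[of "y + of_int (- \<lfloor>y - c\<rfloor>)"])
    show "u = to_circle (y + of_int (- \<lfloor>y - c\<rfloor>))"
      by (simp only: to_circle_add_int y)
  qed linarith+
qed

lemma dist_to_circle: "dist (to_circle x) (to_circle y) = dist_int (x - y)"
  by (rule dist_circle.abs_eq)

lemma dist_to_circle_le: "dist (to_circle x) (to_circle y) \<le> \<bar>x - y\<bar>"
  using dist_int_le[of 0 "x - y"] by (simp add: dist_to_circle)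

lemma dist_to_circle_attained:
  obtains y where "u = to_circle y" "\<bar>y - x\<bar> = dist u (to_circle x)"
proof -
  obtain z where z: "u = to_circle z"
    by (rule to_circle_cases[of 0 u])
  obtain m where m: "m \<in> \<int>" "dist_int (z - x) = \<bar>z - x - m\<bar>"
    by (rule dist_int_attained)
  show thesis
  proof (rule that[of "z - m"])
    show "u = to_circle (z - m)"
      using m by (simp add: z to_circle_eq_iff)
    show "\<bar>z - m - x\<bar> = dist u (to_circle x)"
      using m by (simp add: z dist_to_circle algebra_simps)
  qed
qed

lemma diameter_arc_le:
  assumes "u \<le> v"
  shows "bounded (to_circle ` {u..v})" "diameter (to_circle ` {u..v}) \<le> v - u"
proof -
  have *: "dist x y \<le> v - u" if xy: "x \<in> to_circle ` {u..v}" "y \<in> to_circle ` {u..v}" for x y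
  proof -
    obtain x' y' where "x' \<in> {u..v}" "y' \<in> {u..v}" "x = to_circle x'" "y = to_circle y'"
      using xy by blast
    then show ?thesis
      using dist_to_circle_le[of x' y'] by auto
  qed
  then show "bounded (to_circle ` {u..v})"
    unfolding bounded_two_points by blast
  show "diameter (to_circle ` {u..v}) \<le> v - u"
    using assms * by (auto simp: diameter_def intro!: cSUP_least)
qed

section \<open>The complement of finitely many gaps\<close>

text \<open>Any one of the open intervals splits \<open>[c, d]\<close> into a left and a right part, and disjointness puts
  each other interval into one of the two.  Arguing by induction on both parts avoids having to sort
  the intervals.\<close>

lemma interval_gaps_cover:
  fixes b l :: "'i \<Rightarrow> real"
  assumes "finite K" "c \<le> d"
    and "\<And>k. k \<in> K \<Longrightarrow> 0 < l k \<and> c \<le> b k \<and> b k + l k \<le> d"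
    and "disjoint_family_on (\<lambda>k. {b k<..<b k + l k}) K"
  shows "\<exists>xs. length xs = Suc (card K) \<and> (\<forall>(u, v)\<in>set xs. u \<le> v) \<and>
           (\<Sum>(u, v)\<leftarrow>xs. v - u) = d - c - sum l K \<and>
           {c..d} - (\<Union>k\<in>K. {b k<..<b k + l k}) \<subseteq> (\<Union>(u, v)\<in>set xs. {u..v})"
  using assms
proof (induction K arbitrary: c d rule: finite_psubset_induct)
  case (psubset K c d)
  show ?case
  proof (cases "K = {}")
    case True
    then show ?thesis
      using psubset.prems by (intro exI[of _ "[(c, d)]"]) auto
  next
    case False
    then obtain i where i: "i \<in> K"
      by blast
    let ?I = "\<lambda>k. {b k<..<b k + l k}"
    define K1 where "K1 = {k \<in> K. b k + l k \<le> b i}"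
    define K2 where "K2 = {k \<in> K. b i + l i \<le> b k}"
    have pos: "0 < l k" if "k \<in> K" for k
      using psubset.prems that by blast
    have split: "K = insert i (K1 \<union> K2)"
    proof -
      have "b k + l k \<le> b i \<or> b i + l i \<le> b k" if k: "k \<in> K" "k \<noteq> i" for k
      proof (rule ccontr)
        assume "\<not> ?thesis"
        then have "(max (b k) (b i) + min (b k + l k) (b i + l i)) / 2 \<in> ?I k \<inter> ?I i"
          using pos[OF k(1)] pos[OF i] by (auto simp: max_def min_def field_simps)
        then show False
          using psubset.prems(3) k i unfolding disjoint_family_on_def by blast
      qed
      then show ?thesis
        using i by (auto simp: K1_def K2_def)
    qed
    have fin: "finite K1" "finite K2"
      using psubset.hyps by (auto simp: K1_def K2_def)
    have disj: "i \<notin> K1" "i \<notin> K2" "K1 \<inter> K2 = {}"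
      using pos[OF i] by (auto simp: K1_def K2_def disjoint_iff dest!: pos)
    have sub: "K1 \<subset> K" "K2 \<subset> K"
      using disj i by (auto simp: K1_def K2_def)
    obtain xs where xs: "length xs = Suc (card K1)" "\<forall>(u, v)\<in>set xs. u \<le> v"
        "(\<Sum>(u, v)\<leftarrow>xs. v - u) = b i - c - sum l K1"
        "{c..b i} - (\<Union>k\<in>K1. ?I k) \<subseteq> (\<Union>(u, v)\<in>set xs. {u..v})"
    proof (rule exE[OF psubset.IH[OF sub(1), of c "b i"]])
      show "disjoint_family_on ?I K1"
        using psubset.prems(3) sub by (auto simp: disjoint_family_on_def)
    qed (use psubset.prems i in \<open>auto simp: K1_def\<close>)
    obtain ys where ys: "length ys = Suc (card K2)" "\<forall>(u, v)\<in>set ys. u \<le> v"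
        "(\<Sum>(u, v)\<leftarrow>ys. v - u) = d - (b i + l i) - sum l K2"
        "{b i + l i..d} - (\<Union>k\<in>K2. ?I k) \<subseteq> (\<Union>(u, v)\<in>set ys. {u..v})"
    proof (rule exE[OF psubset.IH[OF sub(2), of "b i + l i" d]])
      show "disjoint_family_on ?I K2"
        using psubset.prems(3) sub by (auto simp: disjoint_family_on_def)
    qed (use psubset.prems i in \<open>auto simp: K2_def\<close>)
    show ?thesis
    proof (intro exI conjI)
      show "length (xs @ ys) = Suc (card K)"
        using xs ys fin disj by (simp add: split card_Un_disjoint)
      show "\<forall>(u, v)\<in>set (xs @ ys). u \<le> v"
        using xs ys by auto
      have "sum l K = l i + (sum l K1 + sum l K2)"
        using fin disj by (simp add: split sum.union_disjoint)
      then show "(\<Sum>(u, v)\<leftarrow>xs @ ys. v - u) = d - c - sum l K"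
        using xs(3) ys(3) by simp
      have "x \<in> (\<Union>(u, v)\<in>set (xs @ ys). {u..v})"
        if x: "x \<in> {c..d}" "\<And>k. k \<in> K \<Longrightarrow> x \<notin> ?I k" for x
      proof -
        have "x \<le> b i \<or> b i + l i \<le> x"
          using x(2)[OF i] by auto
        then have "x \<in> {c..b i} - (\<Union>k\<in>K1. ?I k) \<or> x \<in> {b i + l i..d} - (\<Union>k\<in>K2. ?I k)"
          using x sub by auto
        then show ?thesis
          using subsetD[OF xs(4), of x] subsetD[OF ys(4), of x] by (elim disjE) simp_all
      qed
      then show "{c..d} - (\<Union>k\<in>K. ?I k) \<subseteq> (\<Union>(u, v)\<in>set (xs @ ys). {u..v})"
        by blast
    qed
  qed
qed

text \<open>Cutting the circle open along one of the arcs leaves an interval, in which the other arcs are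
  intervals.  The cut saves one complementary arc, so that there are as many of them as gaps.\<close>

lemma circle_gaps_cover:
  fixes l :: "'i \<Rightarrow> real"
  assumes "finite K" "K \<noteq> {}"
    and arc: "\<And>k. k \<in> K \<Longrightarrow> open_arc (l k) (J k)"
    and disj: "disjoint_family_on J K"
  shows "\<exists>xs. length xs = card K \<and> (\<forall>(u, v)\<in>set xs. u \<le> v) \<and>
           (\<Sum>(u, v)\<leftarrow>xs. v - u) = 1 - sum l K \<and>
           UNIV - (\<Union>k\<in>K. J k) \<subseteq> (\<Union>(u, v)\<in>set xs. to_circle ` {u..v})"
proof -
  obtain i where i: "i \<in> K"
    using assms by blast
  obtain a where a: "J i = to_circle ` {a<..<a + l i}"
    using arc[OF i] by (auto simp: open_arc_def)
  have len: "0 < l k" "l k < 1" if "k \<in> K" for k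
    using arc[OF that] by (auto simp: open_arc_def)
  have "\<exists>b. a + l i \<le> b \<and> b < a + l i + 1 \<and> J k = to_circle ` {b<..<b + l k}" if k: "k \<in> K" for k
  proof -
    obtain b where b: "J k = to_circle ` {b<..<b + l k}"
      using arc[OF k] by (auto simp: open_arc_def)
    obtain b' where b': "a + l i \<le> b'" "b' < a + l i + 1" "to_circle b = to_circle b'"
      by (rule to_circle_cases)
    then obtain m where m: "b = b' + of_int m"
      by (auto simp: to_circle_eq_iff elim!: Ints_cases) (metis add_diff_cancel_left' diff_add_cancel add.commute)
    have "{b<..<b + l k} = (\<lambda>x. x + of_int m) ` {b'<..<b' + l k}"
      unfolding m by (auto intro: image_eqI[of _ _ "x - of_int m" for x])
    then have "J k = to_circle ` {b'<..<b' + l k}"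
      by (simp add: b image_image)
    then show ?thesis
      using b' by blast
  qed
  then obtain b where b: "\<And>k. k \<in> K \<Longrightarrow> a + l i \<le> b k" "\<And>k. k \<in> K \<Longrightarrow> b k < a + l i + 1"
      "\<And>k. k \<in> K \<Longrightarrow> J k = to_circle ` {b k<..<b k + l k}"
    by metis
  \<comment> \<open>An arc that starts in the remaining interval and sticks out of it would meet the next copy of \<open>J i\<close>.\<close>
  have right: "b k + l k \<le> a + 1" if k: "k \<in> K" "k \<noteq> i" for k
  proof (rule ccontr)
    assume "\<not> ?thesis"
    then have "max (b k) (a + 1) < min (b k + l k) (a + 1 + l i)"
      using b(2)[OF k(1)] len[OF i] len[OF k(1)] by auto
    then obtain x where x: "max (b k) (a + 1) < x" "x < min (b k + l k) (a + 1 + l i)"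
      using dense by blast
    have "to_circle x \<in> J k"
      using x by (subst b(3)[OF k(1)]) auto
    moreover have "to_circle x = to_circle (x - 1)"
      by (simp add: to_circle_eq_iff)
    then have "to_circle x \<in> J i"
      using x unfolding a by (intro image_eqI[of _ _ "x - 1"]) auto
    ultimately show False
      using disj k i unfolding disjoint_family_on_def by blast
  qed
  have "disjoint_family_on (\<lambda>k. {b k<..<b k + l k}) (K - {i})"
    unfolding disjoint_family_on_def
  proof (intro ballI impI)
    fix j k assume jk: "j \<in> K - {i}" "k \<in> K - {i}" "j \<noteq> k"
    then have "J j \<inter> J k = {}"
      using disj unfolding disjoint_family_on_def by blast
    then show "{b j<..<b j + l j} \<inter> {b k<..<b k + l k} = {}"
      using b(3)[of j] b(3)[of k] jk by blast
  qed
  then have "\<exists>xs. length xs = Suc (card (K - {i})) \<and> (\<forall>(u, v)\<in>set xs. u \<le> v) \<and>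
        (\<Sum>(u, v)\<leftarrow>xs. v - u) = a + 1 - (a + l i) - sum l (K - {i}) \<and>
        {a + l i..a + 1} - (\<Union>k\<in>K - {i}. {b k<..<b k + l k}) \<subseteq> (\<Union>(u, v)\<in>set xs. {u..v})"
    using assms(1) len[OF i] len b(1) right by (intro interval_gaps_cover) auto
  then obtain xs where xs: "length xs = Suc (card (K - {i}))" "\<forall>(u, v)\<in>set xs. u \<le> v"
        "(\<Sum>(u, v)\<leftarrow>xs. v - u) = a + 1 - (a + l i) - sum l (K - {i})"
        "{a + l i..a + 1} - (\<Union>k\<in>K - {i}. {b k<..<b k + l k}) \<subseteq> (\<Union>(u, v)\<in>set xs. {u..v})"
    by blast
  show ?thesis
  proof (intro exI conjI)
    show "length xs = card K"
      using xs(1) card.remove[OF assms(1) i] by simp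
    show "(\<Sum>(u, v)\<leftarrow>xs. v - u) = 1 - sum l K"
      using xs(3) sum.remove[OF assms(1) i, of l] by simp
    show "UNIV - (\<Union>k\<in>K. J k) \<subseteq> (\<Union>(u, v)\<in>set xs. to_circle ` {u..v})"
    proof
      fix t assume t: "t \<in> UNIV - (\<Union>k\<in>K. J k)"
      obtain x where x: "a \<le> x" "x < a + 1" "t = to_circle x"
        by (rule to_circle_cases)
      have "x \<notin> {a<..<a + l i}"
        using t i a x(3) by blast
      then have "x = a \<or> a + l i \<le> x"
        using x(1) by auto
      then have "\<exists>y\<ge>a + l i. y \<le> a + 1 \<and> t = to_circle y"
      proof
        assume "x = a"
        then have "t = to_circle (a + 1)"
          using x(3) by (simp add: to_circle_eq_iff)
        then show ?thesis
          using len[OF i] by (intro exI[of _ "a + 1"]) simp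
      next
        assume "a + l i \<le> x"
        then show ?thesis
          using x by (intro exI[of _ x]) simp
      qed
      then obtain y where y: "a + l i \<le> y" "y \<le> a + 1" "t = to_circle y"
        by blast
      have "y \<notin> {b k<..<b k + l k}" if "k \<in> K - {i}" for k
        using that t b(3)[of k] y by blast
      then have "y \<in> (\<Union>(u, v)\<in>set xs. {u..v})"
        using subsetD[OF xs(4), of y] y by simp
      then show "t \<in> (\<Union>(u, v)\<in>set xs. to_circle ` {u..v})"
        using y by auto
    qed
  qed (rule xs(2))
qed

text \<open>A substitute for the concavity of \<open>x powr \<beta>\<close>: one summand dominates below the threshold \<open>m\<close>, the
  other one above it.  Summed over \<open>N\<close> arcs of total length \<open>T\<close> it gives
  \<open>N * m powr \<beta> + m powr (\<beta> - 1) * T\<close>, which for \<open>m = T / N\<close> is Jensen's bound up to the factor 2; the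
  threshold being free, \<open>T\<close> need only be bounded from above.\<close>

lemma powr_le_const_plus_linear:
  fixes x m \<beta> :: real
  assumes "0 \<le> x" "0 < m" "0 < \<beta>" "\<beta> \<le> 1"
  shows "x powr \<beta> \<le> m powr \<beta> + m powr (\<beta> - 1) * x"
proof (cases "x \<le> m")
  case True
  then have "x powr \<beta> \<le> m powr \<beta>"
    using assms by (intro powr_mono2) auto
  then show ?thesis
    using assms by (simp add: add_increasing2)
next
  case False
  then have "x powr \<beta> = x powr (\<beta> - 1) * x"
    using assms by (simp add: powr_mult_base' powr_diff)
  also have "\<dots> \<le> m powr (\<beta> - 1) * x"
    using False assms by (intro mult_right_mono powr_mono2') auto
  finally show ?thesis
    by (simp add: add_increasing)
qed

lemma Hausdorff_premeasure_le_arcs: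
  assumes "0 < \<beta>" "0 < r"
    and xs: "\<And>u v. (u, v) \<in> set xs \<Longrightarrow> u \<le> v \<and> v - u < r"
    and cover: "Y \<subseteq> (\<Union>(u, v)\<in>set xs. to_circle ` {u..v})"
  shows "Hausdorff_premeasure \<beta> r Y \<le> ennreal (\<Sum>(u, v)\<leftarrow>xs. (v - u) powr \<beta>)"
proof -
  define U where "U k = (if k < length xs then to_circle ` {fst (xs ! k)..snd (xs ! k)} else {})" for k
  have arc: "fst (xs ! k) \<le> snd (xs ! k)" "snd (xs ! k) - fst (xs ! k) < r" if "k < length xs" for k
    using xs[of "fst (xs ! k)" "snd (xs ! k)"] that by simp_all
  have "bounded (U k) \<and> diameter (U k) < r" for k
    using assms(2) arc[of k] diameter_arc_le[of "fst (xs ! k)" "snd (xs ! k)"] by (auto simp: U_def)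
  moreover have "Y \<subseteq> (\<Union>k. U k)"
  proof
    fix y assume "y \<in> Y"
    then obtain k where "k < length xs" "y \<in> to_circle ` {fst (xs ! k)..snd (xs ! k)}"
      using cover by (fastforce simp: in_set_conv_nth)
    then show "y \<in> (\<Union>k. U k)"
      by (auto simp: U_def)
  qed
  ultimately have "Hausdorff_premeasure \<beta> r Y \<le> (\<Sum>k. diam_powr \<beta> (U k))"
    unfolding Hausdorff_premeasure_def by (intro Inf_lower) blast
  also have "\<dots> = (\<Sum>k<length xs. diam_powr \<beta> (U k))"
    by (rule suminf_finite) (auto simp: U_def diam_powr_def)
  also have "\<dots> \<le> (\<Sum>k<length xs. ennreal ((snd (xs ! k) - fst (xs ! k)) powr \<beta>))"
  proof (rule sum_mono)
    fix k assume "k \<in> {..<length xs}"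
    then show "diam_powr \<beta> (U k) \<le> ennreal ((snd (xs ! k) - fst (xs ! k)) powr \<beta>)"
      using arc[of k] diameter_arc_le[of "fst (xs ! k)" "snd (xs ! k)"] assms(1)
      by (auto simp: U_def diam_powr_def intro!: ennreal_leI powr_mono2 diameter_ge_0)
  qed
  also have "\<dots> = ennreal (\<Sum>(u, v)\<leftarrow>xs. (v - u) powr \<beta>)"
    by (simp add: sum_list_sum_nth case_prod_beta atLeast0LessThan)
  finally show ?thesis .
qed

lemma Hausdorff_premeasure_gap_complement_le:
  assumes "finite K" "K \<noteq> {}" "\<And>k. k \<in> K \<Longrightarrow> open_arc (l k) (J k)" "disjoint_family_on J K"
    and "1 - sum l K < r" "Y \<inter> (\<Union>k\<in>K. J k) = {}"
    and "0 < \<beta>" "\<beta> \<le> 1" "0 < m"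
  shows "Hausdorff_premeasure \<beta> r Y
           \<le> ennreal (real (card K) * m powr \<beta> + m powr (\<beta> - 1) * (1 - sum l K))"
proof -
  obtain xs where xs: "length xs = card K" "\<forall>(u, v)\<in>set xs. u \<le> v"
      "(\<Sum>(u, v)\<leftarrow>xs. v - u) = 1 - sum l K"
      "UNIV - (\<Union>k\<in>K. J k) \<subseteq> (\<Union>(u, v)\<in>set xs. to_circle ` {u..v})"
    using circle_gaps_cover[OF assms(1-4)] by blast
  have le: "v - u \<le> 1 - sum l K" if "(u, v) \<in> set xs" for u v
  proof -
    have "v - u \<in> set (map (\<lambda>(u, v). v - u) xs)"
      using that by force
    then have "v - u \<le> (\<Sum>(u, v)\<leftarrow>xs. v - u)"
      using xs(2) by (intro member_le_sum_list) auto
    then show ?thesis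
      by (simp add: xs(3))
  qed
  have "Hausdorff_premeasure \<beta> r Y \<le> ennreal (\<Sum>(u, v)\<leftarrow>xs. (v - u) powr \<beta>)"
  proof (rule Hausdorff_premeasure_le_arcs)
    have "xs \<noteq> []"
      using xs(1) assms(1,2) by auto
    then obtain u v where "(u, v) \<in> set xs"
      by (metis list.set_intros(1) neq_Nil_conv surj_pair)
    then show "0 < r"
      using le[of u v] xs(2) assms(5) by fastforce
    show "u \<le> v \<and> v - u < r" if "(u, v) \<in> set xs" for u v
      using le[OF that] that xs(2) assms(5) by auto
  qed (use xs(4) assms(6,7) in blast)+
  also have "(\<Sum>(u, v)\<leftarrow>xs. (v - u) powr \<beta>) \<le> (\<Sum>(u, v)\<leftarrow>xs. m powr \<beta> + m powr (\<beta> - 1) * (v - u))"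
    using xs(2) assms powr_le_const_plus_linear[of _ m \<beta>] by (intro sum_list_mono) fastforce
  also have "\<dots> = real (card K) * m powr \<beta> + m powr (\<beta> - 1) * (\<Sum>(u, v)\<leftarrow>xs. v - u)"
    unfolding xs(1)[symmetric] by (induction xs) (auto simp: algebra_simps)
  finally show ?thesis
    by (simp add: xs(3) ennreal_leI)
qed

section \<open>Hitting times of the rotation\<close>

text \<open>Only finitely many \<open>q\<close> violate the bound with \<open>c = 1\<close>, and for these \<open>dist_int (real q * \<alpha>)\<close> is
  positive because \<open>\<alpha>\<close> is irrational.\<close>

lemma Diophantine_class_lower_bound:
  assumes "Diophantine_class \<alpha> (ereal \<nu>)" "\<nu> < \<mu>"
  obtains c where "0 < c" "\<And>q :: nat. 0 < q \<Longrightarrow> c * real q powr (- \<mu>) \<le> dist_int (real q * \<alpha>)"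
proof -
  define E where "E = {q::nat. q > 0 \<and> dist_int (real q * \<alpha>) < real q powr (- \<mu>)}"
  have irr: "\<alpha> \<notin> \<rat>" and fin: "finite E"
    using assms by (auto simp: Diophantine_class_def E_def)
  define c where "c = Min (insert 1 ((\<lambda>q. dist_int (real q * \<alpha>) / real q powr (- \<mu>)) ` E))"
  have pos: "0 < dist_int (real q * \<alpha>)" if "0 < q" for q :: nat
  proof -
    have "real q * \<alpha> \<notin> \<int>"
    proof
      assume "real q * \<alpha> \<in> \<int>"
      then have "real q * \<alpha> / real q \<in> \<rat>"
        by (intro Rats_divide) (auto elim: Ints_cases)
      then show False
        using that irr by simp
    qed
    then show ?thesis
      using dist_int_eq_0_iff[of "real q * \<alpha>"] infdist_nonneg[of "real q * \<alpha>" \<int>] by linarith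
  qed
  show thesis
  proof (rule that[of c])
    show "0 < c"
      using fin pos by (auto simp: c_def E_def)
    show "c * real q powr (- \<mu>) \<le> dist_int (real q * \<alpha>)" if q: "0 < q" for q :: nat
    proof (cases "q \<in> E")
      case True
      then have "c \<le> dist_int (real q * \<alpha>) / real q powr (- \<mu>)"
        using fin by (auto simp: c_def)
      then show ?thesis
        using q by (simp add: pos_le_divide_eq)
    next
      case False
      have "c \<le> 1"
        using fin by (auto simp: c_def)
      then have "c * real q powr (- \<mu>) \<le> 1 * real q powr (- \<mu>)"
        by (rule mult_right_mono) simp
      moreover have "real q powr (- \<mu>) \<le> dist_int (real q * \<alpha>)"
        using False q by (auto simp: E_def)
      ultimately show ?thesis
        by linarith
    qed
  qed
qed

text \<open>The points \<open>n p / q\<close> with \<open>n < q\<close> run modulo 1 through all multiples of \<open>1 / q\<close>, and \<open>n \<alpha>\<close> is closer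
  than \<open>1 / q\<close> to \<open>n p / q\<close>.\<close>

lemma rotation_orbit_hits_interval_coprime:
  fixes \<alpha> y :: real and p :: int and q :: nat
  assumes "0 < q" "coprime p (int q)" "\<bar>real q * \<alpha> - of_int p\<bar> < 1 / real q"
  obtains n :: nat and m :: int where "n < q" "y < real n * \<alpha> + of_int m" "real n * \<alpha> + of_int m < y + 3 / real q"
proof -
  \<comment> \<open>\<open>j / q\<close> lies in \<open>(y + 1 / q, y + 2 / q]\<close>, which leaves room \<open>1 / q\<close> on both sides in \<open>(y, y + 3 / q)\<close>.\<close>
  define j where "j = \<lfloor>real q * y\<rfloor> + 2"
  obtain r s where rs: "r * p + s * int q = 1"
    using bezout_int[of p "int q"] assms(2) by auto
  define n where "n = nat ((r * j) mod int q)"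
  have n: "int n = (r * j) mod int q" "n < q"
    using assms(1) by (simp_all add: n_def nat_less_iff)
  define m where "m = s * j + p * ((r * j) div int q)"
  have "p * int n + int q * m = (r * p + s * int q) * j"
    unfolding n m_def minus_div_mult_eq_mod[symmetric] by (simp add: algebra_simps)
  then have "j = p * int n + int q * m"
    by (simp add: rs)
  then have j: "real_of_int j = of_int p * real n + real q * of_int m"
    by (metis of_int_add of_int_mult of_int_of_nat_eq)
  have "real q * \<bar>real n * \<alpha> + of_int m - of_int j / real q\<bar> = \<bar>real n * (real q * \<alpha> - of_int p)\<bar>"
  proof -
    have "real q * (real n * \<alpha> + of_int m - of_int j / real q) = real n * (real q * \<alpha> - of_int p)"
      using assms(1) unfolding j by (simp add: field_simps)
    then show ?thesis
      by (metis abs_mult abs_of_nat)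
  qed
  also have "\<dots> = real n * \<bar>real q * \<alpha> - of_int p\<bar>"
    by (simp add: abs_mult)
  also have "\<dots> \<le> real n * (1 / real q)"
    using assms(3) by (intro mult_left_mono) auto
  also have "\<dots> < 1"
    using n(2) by (simp add: field_simps)
  finally have "\<bar>real n * \<alpha> + of_int m - of_int j / real q\<bar> < 1 / real q"
    using assms(1) by (simp add: field_simps)
  moreover have "y + 1 / real q < of_int j / real q" "of_int j / real q \<le> y + 2 / real q"
  proof -
    have "real q * y + 1 < of_int j" "of_int j \<le> real q * y + 2"
      unfolding j_def by linarith+
    then have "(real q * y + 1) / real q < of_int j / real q" "of_int j / real q \<le> (real q * y + 2) / real q"
      using assms(1) by (simp_all only: divide_strict_right_mono divide_right_mono of_nat_0_less_iff of_nat_0_le_iff)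
    then show "y + 1 / real q < of_int j / real q" "of_int j / real q \<le> y + 2 / real q"
      using assms(1) by (simp_all add: add_divide_distrib)
  qed
  moreover have "3 / real q = 1 / real q + 2 / real q"
    by (simp add: add_divide_distrib[symmetric])
  ultimately have "y < real n * \<alpha> + of_int m" "real n * \<alpha> + of_int m < y + 3 / real q"
    by linarith+
  with n(2) show thesis
    by (rule that)
qed

text \<open>Dirichlet's theorem gives a coprime fraction \<open>p / q\<close> with \<open>q \<le> Q\<close> and error \<open>\<bar>q \<alpha> - p\<bar> < 1 / Q\<close>.  The
  Diophantine bound turns the small error into \<open>q powr \<mu> > c * Q\<close>, so that the \<open>q\<close> points of the
  preceding lemma are dense enough.  Thus about \<open>t powr (- \<mu>)\<close> orbit points suffice to meet every
  interval of length \<open>t\<close>.\<close>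

lemma rotation_orbit_hits_interval:
  assumes "0 < c" "0 < \<mu>" and dioph: "\<And>q :: nat. 0 < q \<Longrightarrow> c * real q powr (- \<mu>) \<le> dist_int (real q * \<alpha>)"
  obtains B where "0 < B" "\<And>y t. 0 < t \<Longrightarrow> t \<le> 1 \<Longrightarrow>
    \<exists>(n :: nat) (m :: int). real n + 1 \<le> B * t powr (- \<mu>) \<and>
      y < real n * \<alpha> + of_int m \<and> real n * \<alpha> + of_int m < y + t"
proof -
  define B where "B = 3 powr \<mu> / c + 1"
  show thesis
  proof (rule that[of B])
    show "0 < B"
      using assms by (simp add: B_def add_pos_pos)
    fix y t :: real assume t: "0 < t" "t \<le> 1"
    \<comment> \<open>With \<open>c * Q \<ge> (3 / t) powr \<mu>\<close> the bound \<open>q powr \<mu> > c * Q\<close> implies \<open>3 / q < t\<close>.\<close>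
    define Q where "Q = nat \<lceil>(3 / t) powr \<mu> / c\<rceil>"
    have Q: "(3 / t) powr \<mu> / c \<le> real Q" "real Q \<le> (3 / t) powr \<mu> / c + 1"
      unfolding Q_def using assms t by (simp_all add: of_nat_ceiling)
    have "0 < (3 / t) powr \<mu> / c"
      using assms t by simp
    then have "0 < Q"
      using Q(1) by (cases Q) auto
    then obtain p k where pk: "coprime p k" "0 < k" "k \<le> int Q" "\<bar>of_int k * \<alpha> - of_int p\<bar> < 1 / Q"
      by (rule Dirichlet_approx_coprime)
    define q where "q = nat k"
    have q: "0 < q" "q \<le> Q" "coprime p (int q)" "\<bar>real q * \<alpha> - of_int p\<bar> < 1 / real Q"
      using pk by (auto simp: q_def)
    have "\<bar>real q * \<alpha> - of_int p\<bar> < 1 / real q"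
      using q by (smt (verit) frac_le of_nat_0_less_iff of_nat_mono)
    then obtain n m where nm: "n < q" "y < real n * \<alpha> + of_int m" "real n * \<alpha> + of_int m < y + 3 / real q"
      using rotation_orbit_hits_interval_coprime q by metis
    have "c * real q powr (- \<mu>) < 1 / real Q"
      using dioph[OF q(1)] dist_int_le[of "of_int p" "real q * \<alpha>"] q(4) by simp
    then have "c * real Q < real q powr \<mu>"
      using q \<open>0 < Q\<close> by (simp add: powr_minus field_simps)
    then have "(3 / t) powr \<mu> < real q powr \<mu>"
      using Q(1) assms(1) by (simp add: field_simps)
    then have "3 / t < real q"
      using assms(2) t by (meson linorder_not_le of_nat_0_le_iff powr_mono2 less_imp_le)
    then have "3 / real q < t"
      using t q(1) by (simp add: field_simps)
    moreover have "real n + 1 \<le> B * t powr (- \<mu>)"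
    proof -
      have "real n + 1 \<le> (3 / t) powr \<mu> / c + 1"
        using nm(1) q(2) Q(2) by linarith
      also have "\<dots> \<le> 3 powr \<mu> / c * t powr (- \<mu>) + t powr (- \<mu>)"
      proof -
        have "t powr 0 \<le> t powr (- \<mu>)"
          using t assms(2) by (intro powr_mono') auto
        then show ?thesis
          using t powr_divide[of 3 t \<mu>] by (simp add: powr_minus divide_inverse mult_ac)
      qed
      finally show ?thesis
        by (simp add: B_def algebra_simps)
    qed
    ultimately show "\<exists>(n :: nat) (m :: int). real n + 1 \<le> B * t powr (- \<mu>) \<and>
      y < real n * \<alpha> + of_int m \<and> real n * \<alpha> + of_int m < y + t"
      using nm by (intro exI[of _ n] exI[of _ m]) auto
  qed
qed

section \<open>Decay of Denjoy sequences\<close>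

text \<open>With \<open>z = x powr \<gamma>\<close> the hypothesis gives \<open>y \<ge> x (1 - z)\<close>, and
  \<open>(1 - z) powr (- \<gamma>) \<le> 1 / (1 - z) \<le> 1 + 2 z\<close>.\<close>

lemma powr_neg_step:
  fixes x y \<gamma> :: real
  assumes "0 < x" "0 < \<gamma>" "\<gamma> \<le> 1" "x powr \<gamma> \<le> 1 / 2" "\<bar>x - y\<bar> \<le> x powr (1 + \<gamma>)"
  shows "y powr (- \<gamma>) \<le> x powr (- \<gamma>) + 2"
proof -
  define z where "z = x powr \<gamma>"
  have z: "0 < z" "z \<le> 1 / 2"
    using assms by (simp_all add: z_def)
  have "x * (1 - z) \<le> y"
    using assms by (simp add: powr_add z_def algebra_simps)
  then have "y powr (- \<gamma>) \<le> (x * (1 - z)) powr (- \<gamma>)"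
    using assms z by (intro powr_mono2') auto
  also have "\<dots> = (1 - z) powr (- \<gamma>) / z"
  proof -
    have "x powr (- \<gamma>) = 1 / z"
      by (simp add: z_def powr_minus_divide)
    then show ?thesis
      using assms z by (subst powr_mult) auto
  qed
  also have "(1 - z) powr (- \<gamma>) \<le> (1 - z) powr (- 1)"
    using assms z by (intro powr_mono') auto
  also have "\<dots> = 1 / (1 - z)"
    using z by (simp add: powr_minus field_simps)
  also have "\<dots> \<le> 1 + 2 * z"
  proof -
    have "0 \<le> z * (1 - 2 * z)"
      using z by simp
    then show ?thesis
      using z by (simp add: field_simps)
  qed
  also have "(1 + 2 * z) / z = x powr (- \<gamma>) + 2"
    using assms z by (simp add: powr_minus z_def field_simps)
  finally show ?thesis
    using z by (simp add: divide_right_mono)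
qed

text \<open>By the preceding lemma \<open>u n powr (- \<gamma>)\<close> grows by at most 2 in each step from some index on, hence
  at most linearly.\<close>

lemma power_law_lower_bound:
  fixes u :: "nat \<Rightarrow> real"
  assumes "\<And>n. 0 < u n" "u \<longlonglongrightarrow> 0" "0 < \<gamma>" "\<gamma> \<le> 1"
    and "\<forall>\<^sub>F n in sequentially. \<bar>u n - u (Suc n)\<bar> \<le> u n powr (1 + \<gamma>)"
  obtains A where "0 < A" "\<And>n. (A * (real n + 1)) powr (- (1 / \<gamma>)) \<le> u n"
proof -
  have "(\<lambda>n. u n powr \<gamma>) \<longlonglongrightarrow> 0"
    using tendsto_powr'[OF assms(2) tendsto_const[of \<gamma>]] assms by (simp add: less_imp_le)
  then have "\<forall>\<^sub>F n in sequentially. u n powr \<gamma> < 1 / 2"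
    by (rule order_tendstoD) simp
  with assms(5) have "\<forall>\<^sub>F n in sequentially. u (Suc n) powr (- \<gamma>) \<le> u n powr (- \<gamma>) + 2"
    by eventually_elim (use assms powr_neg_step in \<open>auto simp: less_imp_le\<close>)
  then obtain N where N: "\<And>n. n \<ge> N \<Longrightarrow> u (Suc n) powr (- \<gamma>) \<le> u n powr (- \<gamma>) + 2"
    by (auto simp: eventually_sequentially)
  define A where "A = 2 + (\<Sum>n\<le>N. u n powr (- \<gamma>))"
  have A2: "2 \<le> A"
    by (simp add: A_def sum_nonneg)
  have bound: "u n powr (- \<gamma>) \<le> A * (real n + 1)" for n
  proof (induction n)
    case 0
    have "u 0 powr (- \<gamma>) \<le> (\<Sum>n\<le>N. u n powr (- \<gamma>))"
      by (rule member_le_sum) auto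
    then show ?case
      by (simp add: A_def)
  next
    case (Suc n)
    show ?case
    proof (cases "n \<ge> N")
      case True
      then show ?thesis
        using N[OF True] Suc A2 by (simp add: algebra_simps)
    next
      case False
      then have "u (Suc n) powr (- \<gamma>) \<le> (\<Sum>n\<le>N. u n powr (- \<gamma>))"
        by (intro member_le_sum) auto
      then have "u (Suc n) powr (- \<gamma>) \<le> A * 1"
        by (simp add: A_def)
      also have "\<dots> \<le> A * (real (Suc n) + 1)"
        using A2 by (intro mult_left_mono) auto
      finally show ?thesis .
    qed
  qed
  show thesis
  proof (rule that[of A])
    fix n
    have "(A * (real n + 1)) powr (- (1 / \<gamma>)) \<le> (u n powr (- \<gamma>)) powr (- (1 / \<gamma>))"
      using bound[of n] assms(1)[of n] assms(3) by (intro powr_mono2') auto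
    also have "\<dots> = u n"
      using assms(1)[of n] assms(3) by (simp add: powr_powr)
    finally show "(A * (real n + 1)) powr (- (1 / \<gamma>)) \<le> u n" .
  qed (use A2 in simp)
qed

lemma Denjoy_sequence_lt_1:
  assumes "Denjoy_sequence d l"
  shows "l n < 1"
proof -
  have l: "\<And>k. 0 < l k" "(l has_sum 1) UNIV"
    using assms by (auto simp: Denjoy_sequence_def)
  have "sum l {n, n + 1} \<le> 1"
    using l by (intro has_sum_mono_neutral[OF has_sum_finite l(2)]) (auto simp: less_imp_le)
  then show ?thesis
    using l(1)[of "n + 1"] by simp
qed

text \<open>As \<open>ln (l n)\<close> is negative, the lower limit \<open>1 + d\<close> bounds the increments:
  \<open>\<bar>l n - l (n + 1)\<bar> < l n powr (1 + \<gamma>)\<close> for large \<open>n\<close>.\<close>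

lemma Denjoy_sequence_lower_bound:
  assumes "Denjoy_sequence d l" "0 < \<gamma>" "\<gamma> < d" "d \<le> 1"
  obtains A where "0 < A" "\<And>n :: nat. (A * (real n + 1)) powr (- (1 / \<gamma>)) \<le> l (int n)"
proof -
  have l: "\<And>k. 0 < l k" "(l has_sum 1) UNIV"
    "Liminf (sup at_bot at_top) (\<lambda>n. ereal (ln \<bar>l n - l (n + 1)\<bar> / ln (l n))) = ereal (1 + d)"
    using assms by (auto simp: Denjoy_sequence_def)
  have "l summable_on range int"
    using l(2) summable_on_subset_banach[of l UNIV "range int"] by (auto simp: summable_on_def)
  then have "(l \<circ> int) summable_on UNIV"
    by (subst (asm) summable_on_reindex) auto
  then have lim: "(\<lambda>n. l (int n)) \<longlonglongrightarrow> 0"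
    using summable_LIMSEQ_zero[OF summable_on_imp_summable] by (simp add: o_def)
  have "\<forall>\<^sub>F n in sup at_bot at_top. ereal (1 + \<gamma>) < ereal (ln \<bar>l n - l (n + 1)\<bar> / ln (l n))"
    using assms l(3) by (intro less_LiminfD) simp
  then have "\<forall>\<^sub>F n in at_top. 1 + \<gamma> < ln \<bar>l n - l (n + 1)\<bar> / ln (l n)"
    by (simp add: eventually_sup)
  then have "\<forall>\<^sub>F n in sequentially. 1 + \<gamma> < ln \<bar>l (int n) - l (int n + 1)\<bar> / ln (l (int n))"
    by (rule eventually_compose_filterlim[OF _ filterlim_int_sequentially])
  then have "\<forall>\<^sub>F n in sequentially. \<bar>l (int n) - l (int (Suc n))\<bar> \<le> l (int n) powr (1 + \<gamma>)"
  proof eventually_elim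
    case (elim n)
    show ?case
    proof (cases "l (int n) = l (int n + 1)")
      case False
      have "ln (l (int n)) < 0"
        using l(1) Denjoy_sequence_lt_1[OF assms(1)] by simp
      then have "ln \<bar>l (int n) - l (int n + 1)\<bar> < (1 + \<gamma>) * ln (l (int n))"
        using elim by (simp add: neg_less_divide_eq)
      then have "\<bar>l (int n) - l (int n + 1)\<bar> < exp ((1 + \<gamma>) * ln (l (int n)))"
        using False by (metis exp_less_cancel_iff exp_ln zero_less_abs_iff right_minus_eq)
      then show ?thesis
        using l(1)[of "int n"] by (simp add: powr_def add.commute)
    qed (simp add: add.commute)
  qed
  from power_law_lower_bound[OF _ lim assms(2) _ this] that show thesis
    using assms l(1) by auto
qed

section \<open>Hoelder continuity of the semi-conjugacy\<close>

lemma degree_one_add_int: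
  assumes "\<And>x. H (x + 1) = H x + (1 :: real)"
  shows "H (x + of_int m) = H x + of_int m"
proof (induction m rule: int_induct[of _ 0])
  case (step1 i)
  then show ?case
    using assms[of "x + of_int i"] by (simp add: add.assoc)
next
  case (step2 i)
  then show ?case
    using assms[of "x + of_int (i - 1)"] by (simp add: algebra_simps)
qed simp

text \<open>On a lift of the gap, \<open>H\<close> is continuous with values in the discrete set \<open>\<theta> + \<int>\<close>, hence constant.
  Translating the lift of the gap by an integer gives \<open>H\<close> any prescribed value of that set.\<close>

lemma gap_lift:
  assumes H: "circle_lift h H" "\<And>x. H (x + 1) = H x + 1"
    and J: "open_arc L J" "h ` J \<subseteq> {to_circle \<theta>}" and \<phi>: "\<phi> - \<theta> \<in> \<int>"
  obtains a where "J = to_circle ` {a<..<a + L}" "\<And>x. x \<in> {a<..<a + L} \<Longrightarrow> H x = \<phi>"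
proof -
  obtain a where a: "J = to_circle ` {a<..<a + L}" and L: "0 < L"
    using J(1) by (auto simp: open_arc_def)
  let ?c = "a + L / 2"
  have c: "?c \<in> {a<..<a + L}"
    using L by simp
  have int: "H x - \<phi> \<in> \<int>" if "x \<in> {a<..<a + L}" for x
  proof -
    have "to_circle (H x) = h (to_circle x)"
      using H(1) by (simp add: circle_lift_def)
    also have "\<dots> = to_circle \<theta>"
      using J(2) a that by blast
    finally show ?thesis
      using \<phi> Ints_diff[of "H x - \<theta>" "\<phi> - \<theta>"] by (simp add: to_circle_eq_iff)
  qed
  have const: "H x = H ?c" if x: "x \<in> {a<..<a + L}" for x
  proof -
    have "(\<lambda>x. H x - \<phi>) constant_on {a<..<a + L}"
    proof (rule continuous_discrete_range_constant)
      show "continuous_on {a<..<a + L} (\<lambda>x. H x - \<phi>)"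
        using H(1) by (auto simp: circle_lift_def intro!: continuous_intros continuous_on_subset[of UNIV H])
      show "\<exists>e>0. \<forall>y. y \<in> {a<..<a + L} \<and> H y - \<phi> \<noteq> H x - \<phi> \<longrightarrow> e \<le> norm ((H y - \<phi>) - (H x - \<phi>))"
        if "x \<in> {a<..<a + L}" for x
      proof (intro exI[of _ 1] conjI allI impI)
        fix y assume y: "y \<in> {a<..<a + L} \<and> H y - \<phi> \<noteq> H x - \<phi>"
        then show "1 \<le> norm ((H y - \<phi>) - (H x - \<phi>))"
          using Ints_nonzero_abs_ge1[OF Ints_diff[OF int[of y] int[OF that]]] by simp
      qed simp
    qed simp
    then have "H x - \<phi> = H ?c - \<phi>"
      using x c unfolding constant_on_def by metis
    then show ?thesis
      by simp
  qed
  obtain m where m: "H ?c - \<phi> = of_int m"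
    using int[OF c] by (rule Ints_cases)
  show thesis
  proof (rule that[of "a - of_int m"])
    have "{a<..<a + L} = (\<lambda>x. x + of_int m) ` {a - of_int m<..<a - of_int m + L}"
      by (auto intro: image_eqI[of _ _ "x - of_int m" for x])
    then show "J = to_circle ` {a - of_int m<..<a - of_int m + L}"
      by (simp add: a image_image)
    fix x assume "x \<in> {a - of_int m<..<a - of_int m + L}"
    then have "H (x + of_int m) = H ?c"
      by (intro const) auto
    then show "H x = \<phi>"
      using m degree_one_add_int[of H x m] H(2) by simp
  qed
qed

lemma gap_length_le:
  assumes H: "circle_lift h H" "mono H" "\<And>x. H (x + 1) = H x + 1"
    and J: "open_arc L J" "h ` J \<subseteq> {to_circle \<theta>}"
    and m: "H z < \<theta> + of_int m" "\<theta> + of_int m < H w"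
  shows "L \<le> w - z"
proof -
  obtain a where a: "\<And>x. x \<in> {a<..<a + L} \<Longrightarrow> H x = \<theta> + of_int m"
    using gap_lift[OF H(1,3) J, of "\<theta> + of_int m"] by auto
  have *: "z < x" "x < w" if "x \<in> {a<..<a + L}" for x
    using a[OF that] m H(2) by (metis monoD leI not_less)+
  have "0 < L"
    using J(1) by (simp add: open_arc_def)
  moreover have "{a<..<a + L} \<subseteq> {z<..<w}"
    using * by auto
  ultimately show ?thesis
    by (simp add: greaterThanLessThan_subseteq_greaterThanLessThan)
qed

text \<open>If \<open>H\<close> gains height \<open>t\<close> on \<open>[z, w]\<close>, some \<open>n \<alpha>\<close> with \<open>n\<close> at most of order \<open>t powr (- \<mu>)\<close> lies
  strictly between the heights of the endpoints.  The corresponding gap fits between \<open>z\<close> and \<open>w\<close>, and its length is at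
  least of order \<open>n powr (- (1 / \<gamma>))\<close>, that is, \<open>t powr (\<mu> / \<gamma>)\<close>.\<close>

lemma lift_Hoelder:
  assumes H: "circle_lift h H" "mono H" "\<And>x. H (x + 1) = H x + 1"
    and J: "\<And>n :: nat. open_arc (u n) (J n)" "\<And>n. h ` J n \<subseteq> {to_circle (real n * \<alpha>)}"
    and u: "0 < A" "\<And>n. (A * (real n + 1)) powr (- (1 / \<gamma>)) \<le> u n"
    and \<alpha>: "0 < c" "\<And>q :: nat. 0 < q \<Longrightarrow> c * real q powr (- \<mu>) \<le> dist_int (real q * \<alpha>)"
    and pos: "0 < \<gamma>" "0 < \<mu>"
  obtains K where "0 < K" "\<And>z w. z \<le> w \<Longrightarrow> w \<le> z + 1 \<Longrightarrow> H w - H z \<le> K * (w - z) powr (\<gamma> / \<mu>)"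
proof -
  obtain B where B: "0 < B" "\<And>y t. 0 < t \<Longrightarrow> t \<le> 1 \<Longrightarrow>
    \<exists>(n :: nat) (m :: int). real n + 1 \<le> B * t powr (- \<mu>) \<and>
      y < real n * \<alpha> + of_int m \<and> real n * \<alpha> + of_int m < y + t"
    using rotation_orbit_hits_interval[OF \<alpha>(1) pos(2) \<alpha>(2)] by blast
  show thesis
  proof (rule that[of "(A * B) powr (1 / \<mu>)"])
    show "0 < (A * B) powr (1 / \<mu>)"
      using u(1) B(1) by simp
    fix z w :: real assume zw: "z \<le> w" "w \<le> z + 1"
    define t where "t = H w - H z"
    have t: "0 \<le> t" "t \<le> 1"
      using monoD[OF H(2) zw(1)] monoD[OF H(2) zw(2)] H(3)[of z] by (simp_all add: t_def)
    show "H w - H z \<le> (A * B) powr (1 / \<mu>) * (w - z) powr (\<gamma> / \<mu>)"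
    proof (cases "t = 0")
      case False
      with t obtain n m where nm: "real n + 1 \<le> B * t powr (- \<mu>)"
          "H z < real n * \<alpha> + of_int m" "real n * \<alpha> + of_int m < H w"
        using B(2)[of t "H z"] by (auto simp: t_def)
      have "(A * B * t powr (- \<mu>)) powr (- (1 / \<gamma>)) \<le> (A * (real n + 1)) powr (- (1 / \<gamma>))"
        using nm(1) u(1) pos by (intro powr_mono2') (auto simp: mult.assoc)
      also have "\<dots> \<le> w - z"
        using u(2)[of n] gap_length_le[OF H J nm(2,3)] by linarith
      finally have "(A * B * t powr (- \<mu>)) powr (- (1 / \<gamma>)) \<le> w - z" .
      then have "((A * B * t powr (- \<mu>)) powr (- (1 / \<gamma>))) powr (\<gamma> / \<mu>) \<le> (w - z) powr (\<gamma> / \<mu>)"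
        using pos by (intro powr_mono2) auto
      moreover have "((A * B * t powr (- \<mu>)) powr (- (1 / \<gamma>))) powr (\<gamma> / \<mu>)
          = (A * B * t powr (- \<mu>)) powr (- (1 / \<mu>))"
        using pos by (simp add: powr_powr)
      moreover have "\<dots> = (A * B) powr (- (1 / \<mu>)) * t"
        using pos t u(1) B(1) False powr_mult[of "A * B" "t powr (- \<mu>)" "- (1 / \<mu>)"] by (simp add: powr_powr)
      ultimately have "(A * B) powr (- (1 / \<mu>)) * t \<le> (w - z) powr (\<gamma> / \<mu>)"
        by simp
      then show ?thesis
        using u(1) B(1) by (simp add: t_def powr_minus field_simps)
    qed (simp add: t_def[symmetric])
  qed
qed

section \<open>The mass distribution principle\<close>

text \<open>A set of diameter \<open>d\<close> lies in an arc of length \<open>2 d\<close>, whose image under \<open>h\<close> is an arc that the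
  Hoelder bound controls.  The representatives of that image in \<open>[0, 1)\<close> may wrap around once, whence two
  copies of the interval and the factor 2.\<close>

lemma emeasure_lift_image_le:
  assumes H: "circle_lift h H" "mono H" "\<And>x. H (x + 1) = H x + 1"
    and hold: "\<And>z w. z \<le> w \<Longrightarrow> w \<le> z + 1 \<Longrightarrow> H w - H z \<le> K * (w - z) powr p"
    and U: "bounded U" "diameter U \<le> 1 / 2" and "0 \<le> K"
  obtains E where "E \<in> sets lborel" "{y \<in> {0..<1}. to_circle y \<in> h ` U} \<subseteq> E"
    "emeasure lborel E \<le> ennreal (2 * K * (2 * diameter U) powr p)"
proof (cases "U = {}")
  case True
  then show thesis
    using that[of "{}"] by simp
next
  case False
  then obtain t where t: "t \<in> U"
    by blast
  let ?d = "diameter U"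
  have d: "0 \<le> ?d"
    using U by (simp add: diameter_ge_0)
  obtain x' where x': "t = to_circle x'"
    by (rule to_circle_cases[of 0 t])
  \<comment> \<open>The representative \<open>x\<close> of \<open>t\<close> is chosen such that the image interval starts in \<open>[0, 1)\<close>.\<close>
  define x where "x = x' + of_int (- \<lfloor>H (x' - ?d)\<rfloor>)"
  have x: "t = to_circle x"
    unfolding x_def x' by (rule to_circle_add_int[symmetric])
  define a where "a = H (x - ?d)"
  define b where "b = H (x + ?d)"
  have "a = H (x' - ?d) - \<lfloor>H (x' - ?d)\<rfloor>"
    using degree_one_add_int[of H "x' - ?d" "- \<lfloor>H (x' - ?d)\<rfloor>"] H(3)
    by (simp add: a_def x_def algebra_simps)
  then have a: "0 \<le> a" "a < 1"
    by linarith+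
  have b: "a \<le> b" "b \<le> a + 1"
    using monoD[OF H(2), of "x - ?d" "x + ?d"] monoD[OF H(2), of "x + ?d" "x - ?d + 1"] H(3)[of "x - ?d"] d U(2)
    by (simp_all add: a_def b_def)
  have "b - a \<le> K * (2 * ?d) powr p"
    using hold[of "x - ?d" "x + ?d"] d U(2) by (simp add: a_def b_def)
  show thesis
  proof (rule that[of "{a..b} \<union> {a - 1..b - 1}"])
    show "{y \<in> {0..<1}. to_circle y \<in> h ` U} \<subseteq> {a..b} \<union> {a - 1..b - 1}"
    proof
      fix y assume "y \<in> {y \<in> {0..<1}. to_circle y \<in> h ` U}"
      then obtain s where y: "0 \<le> y" "y < 1" and s: "s \<in> U" "to_circle y = h s"
        by auto
      obtain v where v: "s = to_circle v" "\<bar>v - x\<bar> = dist s (to_circle x)"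
        by (rule dist_to_circle_attained)
      have "\<bar>v - x\<bar> \<le> ?d"
        using v diameter_bounded_bound[OF U(1) s(1) t] x by simp
      then have Hv: "a \<le> H v" "H v \<le> b"
        using monoD[OF H(2), of "x - ?d" v] monoD[OF H(2), of v "x + ?d"] by (auto simp: a_def b_def)
      have "to_circle y = to_circle (H v)"
        using H(1) s v by (simp add: circle_lift_def)
      then obtain m where m: "y = H v + of_int m"
        by (auto simp: to_circle_eq_iff elim!: Ints_cases) (metis add.commute diff_add_cancel)
      have "m = 0 \<or> m = - 1"
        using m y Hv a b by linarith
      then show "y \<in> {a..b} \<union> {a - 1..b - 1}"
        using m Hv by auto
    qed
    have "emeasure lborel ({a..b} \<union> {a - 1..b - 1}) \<le> emeasure lborel {a..b} + emeasure lborel {a - 1..b - 1}"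
      by (rule emeasure_subadditive) auto
    also have "\<dots> = ennreal (2 * (b - a))"
      using b by (simp add: ennreal_plus[symmetric] del: ennreal_plus)
    also have "\<dots> \<le> ennreal (2 * K * (2 * ?d) powr p)"
      using \<open>b - a \<le> _\<close> by (intro ennreal_leI) simp
    finally show "emeasure lborel ({a..b} \<union> {a - 1..b - 1}) \<le> ennreal (2 * K * (2 * ?d) powr p)" .
  qed simp
qed

text \<open>The mass distribution principle for the pull-back of Lebesgue measure under \<open>h\<close>, with the measure
  left implicit: the images of the sets of a cover of \<open>Y\<close> cover the circle up to a null set, so their
  measures add up to at least 1, whereas each is at most a constant times the \<open>p\<close>-th power of a
  diameter.\<close>

lemma Hausdorff_measure_pos:
  fixes Y :: "circle set"
  assumes H: "circle_lift h H" "mono H" "\<And>x. H (x + 1) = H x + 1"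
    and hold: "\<And>z w. z \<le> w \<Longrightarrow> w \<le> z + 1 \<Longrightarrow> H w - H z \<le> K * (w - z) powr p"
    and pos: "0 < K" "0 < p" and \<beta>: "0 \<le> \<beta>" "\<beta> \<le> p"
    and Y: "countable {y \<in> {0..<1}. to_circle y \<notin> h ` Y}"
  shows "Hausdorff_measure \<beta> Y \<noteq> 0"
proof -
  define M where "M = 2 * K * 2 powr p"
  have M: "0 < M"
    using pos by (simp add: M_def)
  have lower: "1 \<le> ennreal M * (\<Sum>k. diam_powr \<beta> (U k))"
    if U: "\<And>k. bounded (U k)" "\<And>k. diameter (U k) < 1 / 2" "Y \<subseteq> (\<Union>k. U k)" for U :: "nat \<Rightarrow> circle set"
  proof -
    define N where "N = {y \<in> {0..<1::real}. to_circle y \<notin> h ` Y}"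
    have "\<exists>E. E \<in> sets lborel \<and> {y \<in> {0..<1}. to_circle y \<in> h ` U k} \<subseteq> E \<and>
        emeasure lborel E \<le> ennreal (2 * K * (2 * diameter (U k)) powr p)" for k
    proof (rule emeasure_lift_image_le[OF H hold U(1)[of k]])
      show "diameter (U k) \<le> 1 / 2" "0 \<le> K"
        using U(2)[of k] pos(1) by simp_all
    qed blast+
    then obtain E where E: "\<And>k. E k \<in> sets lborel" "\<And>k. {y \<in> {0..<1}. to_circle y \<in> h ` U k} \<subseteq> E k"
        "\<And>k. emeasure lborel (E k) \<le> ennreal (2 * K * (2 * diameter (U k)) powr p)"
      by metis
    have E': "emeasure lborel (E k) \<le> ennreal M * diam_powr \<beta> (U k)" for k
    proof -
      let ?d = "diameter (U k)"
      have d: "0 \<le> ?d" "?d \<le> 1"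
        using U(1,2)[of k] by (auto simp: diameter_ge_0)
      have "2 * K * (2 * ?d) powr p = M * ?d powr p"
        using d by (simp add: M_def powr_mult)
      also have "ennreal \<dots> = ennreal M * ennreal (?d powr p)"
        using M by (simp add: ennreal_mult)
      also have "\<dots> \<le> ennreal M * diam_powr \<beta> (U k)"
      proof (intro mult_left_mono)
        have "?d powr p \<le> 1"
          using d pos by (intro powr_le1) auto
        moreover have "?d powr p \<le> ?d powr \<beta>"
          using d \<beta> pos by (intro powr_mono') auto
        ultimately show "ennreal (?d powr p) \<le> diam_powr \<beta> (U k)"
          by (auto simp: diam_powr_def ennreal_leI)
      qed simp
      finally show ?thesis
        using E(3)[of k] by (rule order.trans[rotated])
    qed
    have null: "N \<in> null_sets lborel"
      unfolding N_def by (rule countable_imp_null_set_lborel[OF Y])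
    have "1 = emeasure lborel ({0..<1::real} - N)"
      using null by (simp add: emeasure_Diff_null_set)
    also have "\<dots> \<le> emeasure lborel (\<Union>k. E k)"
    proof (rule emeasure_mono)
      show "{0..<1} - N \<subseteq> (\<Union>k. E k)"
      proof
        fix y assume y: "y \<in> {0..<1} - N"
        then obtain s where "s \<in> Y" "to_circle y = h s"
          by (auto simp: N_def)
        then obtain k where "to_circle y \<in> h ` U k"
          using U(3) by blast
        then show "y \<in> (\<Union>k. E k)"
          using y E(2)[of k] by blast
      qed
    qed (use E(1) in auto)
    also have "\<dots> \<le> (\<Sum>k. emeasure lborel (E k))"
      using E(1) by (intro emeasure_subadditive_countably) auto
    also have "\<dots> \<le> (\<Sum>k. ennreal M * diam_powr \<beta> (U k))"
      using E' by (intro suminf_le) auto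
    also have "\<dots> = ennreal M * (\<Sum>k. diam_powr \<beta> (U k))"
      by simp
    finally show ?thesis .
  qed
  have "ennreal (1 / M) \<le> Hausdorff_premeasure \<beta> (1 / 2) Y"
    unfolding Hausdorff_premeasure_def
  proof (rule Inf_greatest, safe)
    fix U :: "nat \<Rightarrow> circle set"
    assume U: "\<forall>k. bounded (U k) \<and> diameter (U k) < 1 / 2" "Y \<subseteq> (\<Union>k. U k)"
    have "ennreal (1 / M) * 1 \<le> ennreal (1 / M) * (ennreal M * (\<Sum>k. diam_powr \<beta> (U k)))"
      using lower[of U] U by (intro mult_left_mono) auto
    also have "\<dots> = (\<Sum>k. diam_powr \<beta> (U k))"
      using M by (simp add: mult.assoc[symmetric] ennreal_mult[symmetric])
    finally show "ennreal (1 / M) \<le> (\<Sum>k. diam_powr \<beta> (U k))"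
      by simp
  qed
  also have "\<dots> \<le> Hausdorff_measure \<beta> Y"
    unfolding Hausdorff_measure_eq_SUP by (rule SUP_upper) simp
  finally show ?thesis
    using M by auto
qed

section \<open>The dimension of the minimal set\<close>

text \<open>For an exponent \<open>p\<close> strictly between \<open>\<beta>\<close> and \<open>\<delta>\<close> the semi-conjugacy is Hoelder of exponent \<open>p\<close>: choose
  \<open>\<gamma> < \<delta>\<close> and \<open>\<mu> > 1\<close> with \<open>\<gamma> / \<mu> = p\<close>.  It maps the minimal set onto the circle up to the countably many
  points \<open>n \<alpha>\<close>, as points of a gap \<open>J n\<close> are sent to \<open>n \<alpha>\<close>.\<close>

lemma Denjoy_map_Hausdorff_measure_pos:
  assumes "0 < \<delta>" "\<delta> \<le> 1" "Diophantine_class \<alpha> 1" "Denjoy_map \<delta> \<alpha> l J f" "0 \<le> \<beta>" "\<beta> < \<delta>"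
  shows "Hausdorff_measure \<beta> (minimal_set J) \<noteq> 0"
proof -
  have seq: "Denjoy_sequence \<delta> l" and J: "\<And>n. open_arc (l n) (J n)"
    using assms(4) by (auto simp: Denjoy_map_def)
  obtain h H where h: "surj h" "\<And>n. h ` closure (J n) = {to_circle (of_int n * \<alpha>)}"
      and H: "circle_lift h H" "mono H" "\<And>x. H (x + 1) = H x + 1"
    using assms(4) by (auto simp: Denjoy_map_def monotone_circle_map_def)
  have hJ: "h ` J n \<subseteq> {to_circle (of_int n * \<alpha>)}" for n
    using h(2)[of n] closure_subset[of "J n"] by blast
  define p where "p = (\<beta> + \<delta>) / 2"
  define \<gamma> where "\<gamma> = (p + \<delta>) / 2"
  define \<mu> where "\<mu> = \<gamma> / p"
  have p: "0 < p" "\<beta> < p" "p < \<gamma>" "\<gamma> < \<delta>"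
    using assms by (simp_all add: p_def \<gamma>_def field_simps)
  have \<mu>: "1 < \<mu>" "\<gamma> / \<mu> = p"
    using p by (simp_all add: \<mu>_def)
  obtain c where c: "0 < c" "\<And>q :: nat. 0 < q \<Longrightarrow> c * real q powr (- \<mu>) \<le> dist_int (real q * \<alpha>)"
    using Diophantine_class_lower_bound[of \<alpha> 1 \<mu>] assms(3) \<mu> by (auto simp: one_ereal_def)
  obtain A where A: "0 < A" "\<And>n :: nat. (A * (real n + 1)) powr (- (1 / \<gamma>)) \<le> l (int n)"
    using Denjoy_sequence_lower_bound[OF seq, of \<gamma>] p assms(2) by auto
  obtain K where K: "0 < K" "\<And>z w. z \<le> w \<Longrightarrow> w \<le> z + 1 \<Longrightarrow> H w - H z \<le> K * (w - z) powr p"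
  proof (rule lift_Hoelder[OF H, of "\<lambda>n. l (int n)" "\<lambda>n. J (int n)" \<alpha> A \<gamma> c \<mu>])
    show "h ` J (int n) \<subseteq> {to_circle (real n * \<alpha>)}" for n
      using hJ[of "int n"] by simp
  qed (use J A c p \<mu> in auto)
  have "{y \<in> {0..<1}. to_circle y \<notin> h ` minimal_set J} \<subseteq> (\<Union>n m. {of_int n * \<alpha> + of_int m})"
  proof
    fix y assume y: "y \<in> {y \<in> {0..<1}. to_circle y \<notin> h ` minimal_set J}"
    obtain s where s: "to_circle y = h s"
      using h(1) by (metis surjD)
    then obtain n where "s \<in> J n"
      using y by (auto simp: minimal_set_def)
    then have "to_circle y = to_circle (of_int n * \<alpha>)"
      using hJ[of n] s by auto
    then obtain m where "y - of_int n * \<alpha> = of_int m"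
      by (auto simp: to_circle_eq_iff elim!: Ints_cases)
    then show "y \<in> (\<Union>n m. {of_int n * \<alpha> + of_int m})"
      by (intro UN_I[of n] UN_I[of m]) (simp_all add: algebra_simps)
  qed
  then have "countable {y \<in> {0..<1}. to_circle y \<notin> h ` minimal_set J}"
    by (rule countable_subset) simp
  with Hausdorff_measure_pos[OF H K(2)] K(1) p assms(5) show ?thesis
    by (meson less_imp_le)
qed

text \<open>Since the lengths of all gaps add up to 1, the arcs complementary to the gaps \<open>J k\<close> with
  \<open>\<bar>k\<bar> \<le> N\<close> have total length \<open>\<Sum>\<bar>k\<bar>>N. l k\<close>, which is \<open>O(N powr (1 - 1 / \<sigma>))\<close> for the \<open>N = n s\<close>.  There are
  \<open>2 N + 1\<close> of them, so their average length is \<open>O(N powr (- (1 / \<sigma>)))\<close>, and the sum of their \<open>\<beta>\<close>-th powers is \<open>O(N powr (1 - \<beta> / \<sigma>))\<close>, which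
  tends to 0.\<close>

lemma Denjoy_map_Hausdorff_measure_eq_0:
  fixes n :: "nat \<Rightarrow> nat"
  assumes map: "Denjoy_map d \<alpha> l J f" and "0 < \<sigma>" "\<sigma> < \<beta>" "\<beta> \<le> 1"
    and n: "strict_mono n" "\<And>s. 0 < n s"
    and tail: "\<And>s. (\<Sum>\<^sub>\<infinity>k\<in>{k. \<bar>k\<bar> > int (n s)}. l k) \<le> C * real (n s) powr (1 - 1 / \<sigma>)"
  shows "Hausdorff_measure \<beta> (minimal_set J) = 0"
proof -
  have arc: "\<And>k. open_arc (l k) (J k)" and disj: "disjoint_family J" and l: "(l has_sum 1) UNIV"
    using map by (auto simp: Denjoy_map_def Denjoy_sequence_def)
  define K where "K s = {- int (n s)..int (n s)}" for s
  have T: "1 - sum l (K s) \<le> C * real (n s) powr (1 - 1 / \<sigma>)" for s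
  proof -
    have "((\<lambda>k. l k) has_sum (1 - sum l (K s))) (UNIV - K s)"
      by (rule has_sum_Diff[OF l]) (auto simp: K_def intro!: has_sum_finite)
    moreover have "UNIV - K s = {k. \<bar>k\<bar> > int (n s)}"
      by (auto simp: K_def)
    ultimately show ?thesis
      using tail[of s] by (simp add: infsumI)
  qed
  have inf: "filterlim (\<lambda>s. real (n s)) at_top sequentially"
    by (intro filterlim_compose[OF filterlim_real_sequentially] filterlim_subseq n)
  have "Hausdorff_premeasure \<beta> r (minimal_set J) \<le> 0" if "0 < r" for r
  proof (rule tendsto_lowerbound)
    have "((\<lambda>s. (3 + C) * real (n s) powr (1 - \<beta> / \<sigma>)) \<longlongrightarrow> (3 + C) * 0) sequentially"
      using assms by (intro tendsto_intros tendsto_neg_powr inf) simp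
    then show "((\<lambda>s. ennreal ((3 + C) * real (n s) powr (1 - \<beta> / \<sigma>))) \<longlongrightarrow> 0) sequentially"
      by (metis ennreal_0 mult_zero_right tendsto_ennrealI)
    have "((\<lambda>s. C * real (n s) powr (1 - 1 / \<sigma>)) \<longlongrightarrow> C * 0) sequentially"
      using assms by (intro tendsto_intros tendsto_neg_powr inf) simp
    then have "\<forall>\<^sub>F s in sequentially. C * real (n s) powr (1 - 1 / \<sigma>) < r"
      using that by (intro order_tendstoD) auto
    then show "\<forall>\<^sub>F s in sequentially. Hausdorff_premeasure \<beta> r (minimal_set J)
        \<le> ennreal ((3 + C) * real (n s) powr (1 - \<beta> / \<sigma>))"
    proof eventually_elim
      case (elim s)
      define N where "N = real (n s)"
      \<comment> \<open>The bound for the average length of the arcs is the threshold that gives both summands the same order.\<close>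
      define m where "m = N powr (- (1 / \<sigma>))"
      have N: "1 \<le> N"
        using n(2)[of s] by (simp add: N_def)
      have "card (K s) = 2 * n s + 1"
        by (simp add: K_def)
      then have card: "real (card (K s)) \<le> 3 * N"
        using N by (simp add: N_def)
      have "m powr (\<beta> - 1) * (1 - sum l (K s)) \<le> m powr (\<beta> - 1) * (C * N powr (1 - 1 / \<sigma>))"
        using T[of s] by (intro mult_left_mono) (auto simp: N_def)
      moreover have "real (card (K s)) * m powr \<beta> \<le> 3 * N * m powr \<beta>"
        using card by (intro mult_right_mono) auto
      moreover have "3 * N * m powr \<beta> = 3 * N powr (1 - \<beta> / \<sigma>)"
        using N powr_add[of N 1 "- (\<beta> / \<sigma>)"] by (simp add: m_def powr_powr)
      moreover have "m powr (\<beta> - 1) * (C * N powr (1 - 1 / \<sigma>)) = C * N powr (1 - \<beta> / \<sigma>)"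
      proof -
        have "- (1 / \<sigma>) * (\<beta> - 1) + (1 - 1 / \<sigma>) = 1 - \<beta> / \<sigma>"
          using assms by (simp add: field_simps)
        then have "m powr (\<beta> - 1) * N powr (1 - 1 / \<sigma>) = N powr (1 - \<beta> / \<sigma>)"
          unfolding m_def powr_powr by (metis powr_add)
        then show ?thesis
          by (metis mult.left_commute)
      qed
      ultimately have "real (card (K s)) * m powr \<beta> + m powr (\<beta> - 1) * (1 - sum l (K s))
          \<le> (3 + C) * N powr (1 - \<beta> / \<sigma>)"
        unfolding distrib_right[of 3 C] by linarith
      moreover have "Hausdorff_premeasure \<beta> r (minimal_set J)
          \<le> ennreal (real (card (K s)) * m powr \<beta> + m powr (\<beta> - 1) * (1 - sum l (K s)))"
      proof (rule Hausdorff_premeasure_gap_complement_le[OF _ _ arc])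
        show "disjoint_family_on J (K s)"
          using disj by (auto simp: disjoint_family_on_def)
        show "1 - sum l (K s) < r"
          using elim T[of s] by simp
      qed (use assms N in \<open>auto simp: K_def m_def minimal_set_def\<close>)
      ultimately show ?case
        unfolding N_def[symmetric] by (meson ennreal_leI order_trans)
    qed
  qed simp
  then show ?thesis
    unfolding Hausdorff_measure_eq_SUP by (simp add: SUP_eq_const le_zero_eq)
qed

theorem corollary19:
  fixes \<delta> \<alpha> :: real and l :: "int \<Rightarrow> real" and J :: "int \<Rightarrow> circle set"
    and f :: "circle \<Rightarrow> circle"
  assumes "0 < \<delta>" and "\<delta> < 1"
    and "Diophantine_class \<alpha> 1"
    and "Denjoy_map \<delta> \<alpha> l J f"
    and "\<forall>\<epsilon>>0. \<exists>(n :: nat \<Rightarrow> nat) (C :: real).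
           strict_mono n \<and> (\<forall>s. n s > 0) \<and>
           (\<forall>s. (\<Sum>\<^sub>\<infinity>k\<in>{k. \<bar>k\<bar> > int (n s)}. l k) \<le> C * real (n s) powr (1 - 1 / (\<delta> + \<epsilon>)))"
  shows "Hausdorff_dim (minimal_set J) = ereal \<delta>"
proof (rule antisym)
  have le: "Hausdorff_dim (minimal_set J) \<le> ereal \<beta>" if \<beta>: "\<delta> < \<beta>" "\<beta> < 1" for \<beta>
  proof -
    obtain n :: "nat \<Rightarrow> nat" and C where "strict_mono n" "\<And>s. 0 < n s"
        "\<And>s. (\<Sum>\<^sub>\<infinity>k\<in>{k. \<bar>k\<bar> > int (n s)}. l k) \<le> C * real (n s) powr (1 - 1 / (\<delta> + (\<beta> - \<delta>) / 2))"
      using assms(5)[rule_format, of "(\<beta> - \<delta>) / 2"] \<beta> by auto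
    then have "Hausdorff_measure \<beta> (minimal_set J) = 0"
      using assms(1,4) \<beta> by (intro Denjoy_map_Hausdorff_measure_eq_0[of \<delta> \<alpha> l J f "\<delta> + (\<beta> - \<delta>) / 2" \<beta> n C])
        (auto simp: field_simps)
    then show ?thesis
      using assms(1) \<beta> unfolding Hausdorff_dim_def by (intro Inf_lower) auto
  qed
  show "Hausdorff_dim (minimal_set J) \<le> ereal \<delta>"
  proof (rule ccontr)
    assume "\<not> ?thesis"
    then have "ereal \<delta> < min (Hausdorff_dim (minimal_set J)) (ereal 1)"
      using assms(2) by simp
    then obtain \<beta> where "ereal \<delta> < ereal \<beta>" "ereal \<beta> < min (Hausdorff_dim (minimal_set J)) (ereal 1)"
      using ereal_dense2 by blast
    then show False
      using le[of \<beta>] by (simp add: not_less[symmetric])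
  qed
  show "ereal \<delta> \<le> Hausdorff_dim (minimal_set J)"
    unfolding Hausdorff_dim_def
  proof (rule Inf_greatest, safe)
    fix \<beta> assume "0 \<le> \<beta>" "Hausdorff_measure \<beta> (minimal_set J) = 0"
    then show "ereal \<delta> \<le> ereal \<beta>"
      using Denjoy_map_Hausdorff_measure_pos[OF assms(1) less_imp_le[OF assms(2)] assms(3,4), of \<beta>] by fastforce
  qed
qed

end
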